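(* Let $\sigma \colon [0,l] \to X_{\mathrm{valid}}$ be a path in $\Sigma$ with arc length $l$. Let $n \geq 1$ and let $0 \leq t_1 < t_2 < \cdots < t_n \leq l$ be a sequence of $n$ real numbers, and set $\delta_i := \delta(\sigma(t_i))$ for $i = 1, \dots, n$. Then the reciprocal clearance cost of $\sigma$ satisfies $$c(\sigma) \geq \ln\left( \frac{\delta_1 + t_1}{\delta_1} \right) + \sum_{i=1}^{n-1} \ln\left( \frac{\left( \delta_i + \delta_{i+1} + t_{i+1} - t_i \right)^2}{4\,\delta_i \delta_{i+1}} \right) + \ln\left( \frac{\delta_n + l - t_n}{\delta_n} \right).$$
   Context: $X$ is a state space, taken to be a subset of a real normed vector space with norm $\|\cdot\|$. $X_{\mathrm{invalid}} \subseteq X$ is the (nonempty) subset of invalid states and $X_{\mathrm{valid}} := X \setminus X_{\mathrm{invalid}}$ is the subset of valid states. The clearance of a valid state is $\delta(\mathbf{x}) := \min_{\mathbf{x}' \in X_{\mathrm{invalid}}} \|\mathbf{x} - \mathbf{x}'\|$; it is assumed that this minimum is attained and is strictly positive for every valid state, so $\delta \colon X_{\mathrm{valid}} \to (0,\infty)$. A path is a continuous function $\sigma \colon [0,l] \to X_{\mathrm{valid}}$ with $0 \leq l < \infty$, parameterized by arc length: for all $0 \leq s \leq t \leq l$ the restriction of $\sigma$ to $[s,t]$ has length $t-s$ with respect to $\|\cdot\|$. The number $l$ is the arc length of $\sigma$. $\Sigma$ denotes the set of all such paths. The reciprocal clearance cost of $\sigma \in \Sigma$ is $c(\sigma) :=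 \int_0^l \frac{1}{\delta(\sigma(t))}\,dt$. An empty sum is $0$. *)

theory Defs
  imports "HOL-Analysis.Analysis"
begin

definition valid_states :: "'a set \<Rightarrow> 'a set \<Rightarrow> 'a set" where
  "valid_states X X_invalid = X - X_invalid"

text \<open>
  The clearance is the minimum distance to an invalid state. It is meaningful only where this
  minimum is attained, which \<open>state_space\<close> below demands for every valid state.
\<close>

definition clearance :: "'a::real_normed_vector set \<Rightarrow> 'a \<Rightarrow> real" where
  "clearance X_invalid x = (LEAST d. \<exists>x'\<in>X_invalid. d = norm (x - x'))"

definition state_space :: "'a::real_normed_vector set \<Rightarrow> 'a set \<Rightarrow> bool" where
  "state_space X X_invalid \<longleftrightarrow>
     X_invalid \<subseteq> X \<and> X_invalid \<noteq> {} \<and>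
     (\<forall>x\<in>valid_states X X_invalid.
        (\<exists>x'\<in>X_invalid. \<forall>y\<in>X_invalid. norm (x - x') \<le> norm (x - y)) \<and>
        clearance X_invalid x > 0)"

text \<open>
  The length of the restriction of a curve to \<open>{s..t}\<close> (for \<open>s \<le> t\<close>), possibly infinite: the
  supremum of the lengths of the polygons inscribed at the partitions
  \<open>s = p 0 \<le> p 1 \<le> \<dots> \<le> p m = t\<close>.
\<close>

definition curve_length :: "(real \<Rightarrow> 'a::real_normed_vector) \<Rightarrow> real \<Rightarrow> real \<Rightarrow> ennreal" where
  "curve_length \<sigma> s t =
     Sup {ennreal (\<Sum>i<m. norm (\<sigma> (p (Suc i)) - \<sigma> (p i))) | m (p :: nat \<Rightarrow> real).
            p 0 = s \<and> p m = t \<and> mono_on {..m} p}"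

text \<open>
  Paths are total functions, of which only the values on \<open>{0..l}\<close> matter. The arc length \<open>l\<close> is
  kept as a separate argument, since the total function does not determine it.
\<close>

definition arc_length_path ::
  "'a::real_normed_vector set \<Rightarrow> 'a set \<Rightarrow> real \<Rightarrow> (real \<Rightarrow> 'a) \<Rightarrow> bool" where
  "arc_length_path X X_invalid l \<sigma> \<longleftrightarrow>
     0 \<le> l \<and> continuous_on {0..l} \<sigma> \<and> \<sigma> \<in> {0..l} \<rightarrow> valid_states X X_invalid \<and>
     (\<forall>s t. 0 \<le> s \<and> s \<le> t \<and> t \<le> l \<longrightarrow> curve_length \<sigma> s t = ennreal (t - s))"

definition reciprocal_clearance_cost ::
  "'a::real_normed_vector set \<Rightarrow> real \<Rightarrow> (real \<Rightarrow> 'a) \<Rightarrow> real" where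
  "reciprocal_clearance_cost X_invalid l \<sigma> = integral {0..l} (\<lambda>t. 1 / clearance X_invalid (\<sigma> t))"

end

theory Submission
  imports Defs
begin

text \<open>
  Along a path the clearance \<open>d\<close> is a positive 1-Lipschitz function of arc length. Hence
  \<open>1 / d u \<ge> 1 / (d s + \<bar>u - s\<bar>)\<close> for every sample \<open>s\<close>, and integrating this away from \<open>s\<close> gives
  a logarithm. Between consecutive samples the two bounds are used on either side of the point
  where they agree.
\<close>

text \<open>\<open>LEAST\<close> on the reals denotes a minimum only if one exists. The attainment
  clause of \<open>state_space\<close> supplies a minimizer, and from here on the clearance is
  handled through that nearest invalid state.\<close>

lemma clearance_attained:
  assumes "state_space X X_invalid" "x \<in> valid_states X X_invalid"
  obtains x' where "x' \<in> X_invalid" "clearance X_invalid x = norm (x - x')"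
    "\<And>y. y \<in> X_invalid \<Longrightarrow> clearance X_invalid x \<le> norm (x - y)"
proof -
  obtain x' where x': "x' \<in> X_invalid" "\<And>y. y \<in> X_invalid \<Longrightarrow> norm (x - x') \<le> norm (x - y)"
    using assms unfolding state_space_def by blast
  have "clearance X_invalid x = norm (x - x')"
    unfolding clearance_def by (rule Least_equality) (use x' in auto)
  with x' that show ?thesis by simp
qed

text \<open>The invalid state nearest to \<open>y\<close> competes in the minimum for
  \<open>x\<close>, and the triangle inequality through \<open>y\<close> bounds its distance from
  \<open>x\<close>.\<close>

lemma clearance_triangle:
  assumes "state_space X X_invalid" "x \<in> valid_states X X_invalid" "y \<in> valid_states X X_invalid"
  shows "clearance X_invalid x \<le> clearance X_invalid y + norm (x - y)"
proof -
  obtain y' where y': "y' \<in> X_invalid" "clearance X_invalid y = norm (y - y')"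
    using clearance_attained[OF assms(1,3)] by metis
  have "clearance X_invalid x \<le> norm (x - y')"
    using clearance_attained[OF assms(1,2)] y'(1) by metis
  also have "\<dots> \<le> norm (x - y) + norm (y - y')"
    using norm_triangle_ineq[of "x - y" "y - y'"] by simp
  finally show ?thesis using y'(2) by simp
qed

lemma norm_diff_le_curve_length:
  assumes "s \<le> t"
  shows "ennreal (norm (\<sigma> t - \<sigma> s)) \<le> curve_length \<sigma> s t"
proof -
  \<comment> \<open>The partition with the single step from \<open>s\<close> to \<open>t\<close>:
    its inscribed polygon is the chord, so the chord length is one member of the set whose supremum
    is the curve length.\<close>
  define p :: "nat \<Rightarrow> real" where "p = (\<lambda>i. if i = 0 then s else t)"
  have "p 0 = s" "p 1 = t" "mono_on {..1} p"
    using assms by (auto simp: p_def mono_on_def)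
  moreover have "norm (\<sigma> t - \<sigma> s) = (\<Sum>i<1. norm (\<sigma> (p (Suc i)) - \<sigma> (p i)))"
    by (simp add: p_def)
  ultimately show ?thesis
    unfolding curve_length_def by (intro Sup_upper CollectI exI[of _ 1] exI[of _ p]) simp
qed

lemma arc_length_path_norm_diff_le:
  assumes "arc_length_path X X_invalid l \<sigma>" "0 \<le> s" "s \<le> t" "t \<le> l"
  shows "norm (\<sigma> t - \<sigma> s) \<le> t - s"
proof -
  have "curve_length \<sigma> s t = ennreal (t - s)"
    using assms unfolding arc_length_path_def by blast
  with norm_diff_le_curve_length[OF assms(3), of \<sigma>] assms(3) show ?thesis by simp
qed

text \<open>Composition of two 1-Lipschitz maps: the clearance with respect to the norm, and the
  path with respect to its arc length parameter, because a chord is no longer than its arc.\<close>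

lemma clearance_lipschitz_on_path:
  assumes "state_space X X_invalid" "arc_length_path X X_invalid l \<sigma>"
  shows "1-lipschitz_on {0..l} (\<lambda>t. clearance X_invalid (\<sigma> t))"
proof (rule lipschitz_onI)
  fix s t assume st: "s \<in> {0..l}" "t \<in> {0..l}"
  then have valid: "\<sigma> s \<in> valid_states X X_invalid" "\<sigma> t \<in> valid_states X X_invalid"
    using assms(2) unfolding arc_length_path_def by auto
  have "norm (\<sigma> s - \<sigma> t) \<le> \<bar>s - t\<bar>"
    using arc_length_path_norm_diff_le[OF assms(2), of s t]
      arc_length_path_norm_diff_le[OF assms(2), of t s] st
    by (cases "s \<le> t") (auto simp: norm_minus_commute)
  then show "dist (clearance X_invalid (\<sigma> s)) (clearance X_invalid (\<sigma> t)) \<le> 1 * dist s t"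
    using clearance_triangle[OF assms(1) valid]
      clearance_triangle[OF assms(1) valid(2,1)]
    by (simp add: dist_real_def norm_minus_commute)
qed simp

lemma lipschitz_reciprocal_integrable:
  fixes f :: "real \<Rightarrow> real"
  assumes "C-lipschitz_on {a..b} f" "\<And>u. u \<in> {a..b} \<Longrightarrow> f u > 0"
  shows "(\<lambda>u. 1 / f u) integrable_on {a..b}"
proof (intro integrable_continuous_interval continuous_intros)
  show "continuous_on {a..b} f" by (rule lipschitz_on_continuous_on[OF assms(1)])
  show "\<forall>x\<in>{a..b}. f x \<noteq> 0" using assms(2) by force
qed

text \<open>The fastest growth that the Lipschitz bound allows is along the line of slope 1 through
  \<open>f a\<close>. The left-hand side is the integral of the reciprocal of that line.\<close>

lemma ln_le_integral_reciprocal_forward: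
  fixes f :: "real \<Rightarrow> real"
  assumes lip: "1-lipschitz_on {a..b} f" and pos: "\<And>u. u \<in> {a..b} \<Longrightarrow> f u > 0" and "a \<le> b"
  shows "ln ((f a + (b - a)) / f a) \<le> integral {a..b} (\<lambda>u. 1 / f u)"
proof (rule has_integral_le)
  have fa: "f a > 0" using pos \<open>a \<le> b\<close> by simp
  \<comment> \<open>An antiderivative is \<open>ln (f a + (u - a))\<close>; its argument stays
    positive as \<open>f a > 0\<close> and \<open>u \<ge> a\<close>.\<close>
  have "((\<lambda>u. 1 / (f a + (u - a))) has_integral
      ln (f a + (b - a)) - ln (f a + (a - a))) {a..b}"
    using \<open>a \<le> b\<close> fa
    by (intro fundamental_theorem_of_calculus)
      (auto intro!: derivative_eq_intros
        simp flip: has_real_derivative_iff_has_vector_derivative)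
  then show "((\<lambda>u. 1 / (f a + (u - a))) has_integral ln ((f a + (b - a)) / f a)) {a..b}"
    using \<open>a \<le> b\<close> fa by (simp add: ln_div)
  show "((\<lambda>u. 1 / f u) has_integral integral {a..b} (\<lambda>u. 1 / f u)) {a..b}"
    using lipschitz_reciprocal_integrable[OF lip pos] by (rule integrable_integral)
  fix u assume u: "u \<in> {a..b}"
  then have "f u \<le> f a + (u - a)"
    using lipschitz_onD[OF lip, of u a] by (auto simp: dist_real_def)
  then show "1 / (f a + (u - a)) \<le> 1 / f u"
    using pos[OF u] by (intro divide_left_mono) auto
qed

text \<open>The reflection of \<open>u\<close> to \<open>- u\<close> exchanges the endpoints and
  preserves both the Lipschitz constant and the integral, so this is the forward bound for the
  reflected function.\<close>

lemma ln_le_integral_reciprocal_backward: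
  fixes f :: "real \<Rightarrow> real"
  assumes lip: "1-lipschitz_on {a..b} f" and pos: "\<And>u. u \<in> {a..b} \<Longrightarrow> f u > 0" and "a \<le> b"
  shows "ln ((f b + (b - a)) / f b) \<le> integral {a..b} (\<lambda>u. 1 / f u)"
proof -
  have "1-lipschitz_on {-b..-a} (\<lambda>u. f (- u))"
  proof (rule lipschitz_onI)
    fix u v assume "u \<in> {-b..-a}" "v \<in> {-b..-a}"
    then show "dist (f (- u)) (f (- v)) \<le> 1 * dist u v"
      using lipschitz_onD[OF lip, of "- u" "- v"] by (auto simp: dist_minus)
  qed simp
  from ln_le_integral_reciprocal_forward[OF this] pos \<open>a \<le> b\<close> show ?thesis
    using Henstock_Kurzweil_Integration.integral_reflect_real[of b a "\<lambda>u. 1 / f u"] by simp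
qed

lemma ln_le_integral_reciprocal_between:
  fixes f :: "real \<Rightarrow> real"
  assumes lip: "1-lipschitz_on {a..b} f" and pos: "\<And>u. u \<in> {a..b} \<Longrightarrow> f u > 0" and "a \<le> b"
  shows "ln ((f a + f b + b - a)\<^sup>2 / (4 * f a * f b)) \<le> integral {a..b} (\<lambda>u. 1 / f u)"
proof -
  \<comment> \<open>The lines \<open>f a + (u - a)\<close> and \<open>f b + (b - u)\<close> cross at
    \<open>u = m\<close>, where both have height \<open>h\<close>.\<close>
  define m where "m = (a + b + f b - f a) / 2"
  define h where "h = (f a + f b + b - a) / 2"
  \<comment> \<open>The Lipschitz bound between the endpoints is exactly what keeps the crossing
    point inside \<open>{a..b}\<close>.\<close>
  have "\<bar>f a - f b\<bar> \<le> b - a"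
    using lipschitz_onD[OF lip, of a b] \<open>a \<le> b\<close> by (simp add: dist_real_def)
  then have m: "a \<le> m" "m \<le> b" unfolding m_def by (auto simp: abs_le_iff)
  have fab: "f a > 0" "f b > 0" using pos \<open>a \<le> b\<close> by auto
  then have h: "h > 0" unfolding h_def using \<open>a \<le> b\<close> by simp
  have hm: "f a + (m - a) = h" "f b + (b - m) = h"
    unfolding m_def h_def by (simp_all add: field_simps)
  \<comment> \<open>The numerator is \<open>(2 * h)\<^sup>2\<close>, which cancels the 4 and leaves
    one factor for each side of \<open>m\<close>.\<close>
  have "ln ((f a + f b + b - a)\<^sup>2 / (4 * f a * f b)) = ln ((h / f a) * (h / f b))"
    unfolding h_def by (simp add: power2_eq_square mult.assoc)
  also have "\<dots> = ln (h / f a) + ln (h / f b)"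
    using h fab by (intro ln_mult_pos) auto
  also have "ln (h / f a) \<le> integral {a..m} (\<lambda>u. 1 / f u)"
    using ln_le_integral_reciprocal_forward[of a m f] lipschitz_on_subset[OF lip, of "{a..m}"]
      pos m hm by auto
  also have "ln (h / f b) \<le> integral {m..b} (\<lambda>u. 1 / f u)"
    using ln_le_integral_reciprocal_backward[of m b f] lipschitz_on_subset[OF lip, of "{m..b}"]
      pos m hm by auto
  also have "integral {a..m} (\<lambda>u. 1 / f u) + integral {m..b} (\<lambda>u. 1 / f u)
      = integral {a..b} (\<lambda>u. 1 / f u)"
    using m lipschitz_reciprocal_integrable[OF lip pos]
    by (intro Henstock_Kurzweil_Integration.integral_combine)
  finally show ?thesis by simp
qed

text \<open>Induction appends the last interval and adds its integral to those before it. At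
  \<open>n = 1\<close> the index range \<open>{1..0}\<close> is empty and the integral is over a
  single point.\<close>

lemma sum_ln_le_integral_reciprocal:
  fixes f :: "real \<Rightarrow> real" and t :: "nat \<Rightarrow> real"
  assumes "n \<ge> 1" "mono_on {1..n} t"
    and "1-lipschitz_on {t 1..t n} f" "\<And>u. u \<in> {t 1..t n} \<Longrightarrow> f u > 0"
  shows "(\<Sum>i=1..n-1. ln ((f (t i) + f (t (i + 1)) + t (i + 1) - t i)\<^sup>2 / (4 * f (t i) * f (t (i + 1)))))
    \<le> integral {t 1..t n} (\<lambda>u. 1 / f u)"
  using assms
proof (induction n rule: nat_induct_at_least)
  case base
  then show ?case by simp
next
  case (Suc n)
  have le: "t 1 \<le> t n" "t n \<le> t (Suc n)"
    using Suc.prems(1) \<open>n \<ge> 1\<close> by (auto simp: mono_on_def)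
  have "{1..Suc n - 1} = insert n {1..n-1}" "n \<notin> {1..n-1}"
    using \<open>n \<ge> 1\<close> by auto
  moreover have "(\<Sum>i=1..n-1. ln ((f (t i) + f (t (i + 1)) + t (i + 1) - t i)\<^sup>2 / (4 * f (t i) * f (t (i + 1)))))
      \<le> integral {t 1..t n} (\<lambda>u. 1 / f u)"
    by (rule Suc.IH[OF mono_on_subset[OF Suc.prems(1)] lipschitz_on_subset[OF Suc.prems(2)]])
      (use le in \<open>auto intro: Suc.prems(3)\<close>)
  moreover have "ln ((f (t n) + f (t (n + 1)) + t (n + 1) - t n)\<^sup>2 / (4 * f (t n) * f (t (n + 1))))
      \<le> integral {t n..t (n + 1)} (\<lambda>u. 1 / f u)"
    by (rule ln_le_integral_reciprocal_between[OF lipschitz_on_subset[OF Suc.prems(2)]])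
      (use le in \<open>auto intro: Suc.prems(3)\<close>)
  moreover have "integral {t 1..t n} (\<lambda>u. 1 / f u) + integral {t n..t (n + 1)} (\<lambda>u. 1 / f u)
      = integral {t 1..t (Suc n)} (\<lambda>u. 1 / f u)"
    using le lipschitz_reciprocal_integrable[OF Suc.prems(2,3)]
    by (simp add: Henstock_Kurzweil_Integration.integral_combine)
  ultimately show ?case by simp
qed

theorem theorem2:
  fixes X X_invalid :: "'a::real_normed_vector set"
    and \<sigma> :: "real \<Rightarrow> 'a" and l :: real
    and n :: nat and t \<delta> :: "nat \<Rightarrow> real"
  assumes "state_space X X_invalid"
    and "arc_length_path X X_invalid l \<sigma>"
    and "n \<ge> 1"
    and "0 \<le> t 1" and "strict_mono_on {1..n} t" and "t n \<le> l"
    and "\<And>i. i \<in> {1..n} \<Longrightarrow> \<delta> i = clearance X_invalid (\<sigma> (t i))"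
  shows "reciprocal_clearance_cost X_invalid l \<sigma> \<ge>
           ln ((\<delta> 1 + t 1) / \<delta> 1)
           + (\<Sum>i=1..n-1. ln ((\<delta> i + \<delta> (i + 1) + t (i + 1) - t i)\<^sup>2 / (4 * \<delta> i * \<delta> (i + 1))))
           + ln ((\<delta> n + l - t n) / \<delta> n)"
proof -
  define f where "f = (\<lambda>u. clearance X_invalid (\<sigma> u))"
  have lip: "1-lipschitz_on {0..l} f"
    unfolding f_def by (rule clearance_lipschitz_on_path[OF assms(1,2)])
  have pos: "f u > 0" if "u \<in> {0..l}" for u
    using assms(1,2) that unfolding f_def state_space_def arc_length_path_def by blast
  \<comment> \<open>\<open>\<delta>\<close> is specified only at the sample indices, so it is
    replaced by \<open>f\<close> index by index; in the sum, \<open>i \<le> n - 1\<close> keeps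
    \<open>i + 1\<close> in range as well.\<close>
  have \<delta>: "\<delta> i = f (t i)" if "i \<in> {1..n}" for i
    using assms(7)[OF that] by (simp add: f_def)
  have mono: "mono_on {1..n} t"
    using assms(5) by (rule strict_mono_on_imp_mono_on)
  then have t1n: "t 1 \<le> t n" using assms(3) by (auto simp: mono_on_def)
  note int = lipschitz_reciprocal_integrable[OF lip pos]
  \<comment> \<open>Before the first sample the known clearance sits at the right end of
    \<open>{0..t 1}\<close>, hence the backward bound; after the last sample it sits at the left end
    of \<open>{t n..l}\<close>, hence the forward one.\<close>
  have "ln ((\<delta> 1 + t 1) / \<delta> 1) \<le> integral {0..t 1} (\<lambda>u. 1 / f u)"
    using ln_le_integral_reciprocal_backward[of 0 "t 1" f]
      lipschitz_on_subset[OF lip, of "{0..t 1}"] pos assms(3,4,6) t1n \<delta>[of 1] by simp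
  moreover have "(\<Sum>i=1..n-1. ln ((\<delta> i + \<delta> (i + 1) + t (i + 1) - t i)\<^sup>2 / (4 * \<delta> i * \<delta> (i + 1))))
      \<le> integral {t 1..t n} (\<lambda>u. 1 / f u)"
  proof -
    have "(\<Sum>i=1..n-1. ln ((\<delta> i + \<delta> (i + 1) + t (i + 1) - t i)\<^sup>2 / (4 * \<delta> i * \<delta> (i + 1))))
      = (\<Sum>i=1..n-1. ln ((f (t i) + f (t (i + 1)) + t (i + 1) - t i)\<^sup>2 / (4 * f (t i) * f (t (i + 1)))))"
      by (intro sum.cong refl) (auto simp: \<delta>)
    also have "\<dots> \<le> integral {t 1..t n} (\<lambda>u. 1 / f u)"
      by (rule sum_ln_le_integral_reciprocal[OF assms(3) mono lipschitz_on_subset[OF lip]])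
        (use assms(4,6) in \<open>auto intro: pos\<close>)
    finally show ?thesis .
  qed
  moreover have "ln ((\<delta> n + l - t n) / \<delta> n) \<le> integral {t n..l} (\<lambda>u. 1 / f u)"
    using ln_le_integral_reciprocal_forward[of "t n" l f]
      lipschitz_on_subset[OF lip, of "{t n..l}"] pos assms(3,4,6) t1n \<delta>[of n]
    by (simp add: add_diff_eq)
  \<comment> \<open>The three bounds concern adjacent intervals, whose integrals add up to the cost
    over \<open>{0..l}\<close>.\<close>
  moreover have "integral {0..t 1} (\<lambda>u. 1 / f u) + integral {t 1..t n} (\<lambda>u. 1 / f u)
      = integral {0..t n} (\<lambda>u. 1 / f u)"
    using assms(4,6) t1n
    by (intro Henstock_Kurzweil_Integration.integral_combine integrable_on_subinterval[OF int]) auto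
  moreover have "integral {0..t n} (\<lambda>u. 1 / f u) + integral {t n..l} (\<lambda>u. 1 / f u)
      = integral {0..l} (\<lambda>u. 1 / f u)"
    using assms(4,6) t1n int by (intro Henstock_Kurzweil_Integration.integral_combine) auto
  moreover have "reciprocal_clearance_cost X_invalid l \<sigma> = integral {0..l} (\<lambda>u. 1 / f u)"
    by (simp add: reciprocal_clearance_cost_def f_def)
  ultimately show ?thesis by linarith
qed

end
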